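(* Let $\Gamma$ be a finite graph and let $G\leq\mathrm{Aut}(\Gamma)$. For $g\in G$ let $c_G(g):=\sum_{H\leq G,\ g\in H}\frac{1}{|H|}$. Then $c_G$ is constant on the conjugacy classes of $G$. Moreover, if $g,h\in G$ are conjugate in $G$, then $\Gamma/g\cong\Gamma/h$ and consequently $P_{\Gamma/g}(x,y)=P_{\Gamma/h}(x,y)$.
   Context: Graphs are finite and undirected; loops are allowed and parallel edges are irrelevant (only adjacency matters). The sum defining $c_G(g)$ ranges over all subgroups $H$ of $G$ containing $g$. For a graph $\Lambda$, the bivariate chromatic polynomial $P_\Lambda(x,y)$ (Dohmen–Pönitz–Tittmann) is the unique polynomial in $x,y$ such that, for all integers $x\ge y\ge 0$, $P_\Lambda(x,y)$ is the number of maps $c:V(\Lambda)\to\{1,\dots,x\}$ such that for every edge $uv$ of $\Lambda$ (including loops, $u=v$) with $c(u)=c(v)$ one has $c(u)>y$. Thus colours $1,\dots,y$ are "proper", colours $y+1,\dots,x$ are "improper", and a vertex carrying a loop can only receive an improper colour. For $g\in G$, the quotient graph $\Gamma/g$ has as vertices the $\langle g\rangle$-orbits on $V(\Gamma)$; two distinct orbits are adjacent iff at least one edge of $\Gamma$ joins them, and an orbit carries a loop iff some edge of $\Gamma$ has both endpoints in that orbit. The symbol $\cong$ denotes isomorphism of graphs (with loops). *)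

theory Defs
  imports
    "HOL-Algebra.Group_Action"
    "HOL-Algebra.Generated_Groups"
    "HOL-Computational_Algebra.Polynomial"
    "Graph_Theory.Graph_Theory"
begin

text \<open>
  A finite undirected graph in which loops are allowed and parallel edges are ignored is a
  \<^locale>\<open>pair_pseudo_graph\<close>: an edge joining \<open>u\<close> and \<open>v\<close> is represented by the two arcs
  \<open>(u, v)\<close> and \<open>(v, u)\<close>, and a loop at \<open>u\<close> by the arc \<open>(u, u)\<close>. Since an arc is determined by
  its endpoints, \<^const>\<open>digraph_iso\<close> on such graphs is isomorphism of graphs with loops.
\<close>

definition aut_group :: "'a pair_pre_digraph \<Rightarrow> ('a \<Rightarrow> 'a) monoid" where
  "aut_group \<Gamma> = BijGroup (pverts \<Gamma>)
     \<lparr>carrier := {f \<in> Bij (pverts \<Gamma>).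
        \<forall>u\<in>pverts \<Gamma>. \<forall>v\<in>pverts \<Gamma>. (f u, f v) \<in> parcs \<Gamma> \<longleftrightarrow> (u, v) \<in> parcs \<Gamma>}\<rparr>"

definition conjugate_in :: "('a, 'b) monoid_scheme \<Rightarrow> 'a \<Rightarrow> 'a \<Rightarrow> bool" where
  "conjugate_in G g h \<longleftrightarrow> g \<in> carrier G \<and> h \<in> carrier G \<and>
     (\<exists>k\<in>carrier G. h = k \<otimes>\<^bsub>G\<^esub> g \<otimes>\<^bsub>G\<^esub> inv\<^bsub>G\<^esub> k)"

definition subgroup_sum :: "('a, 'b) monoid_scheme \<Rightarrow> 'a \<Rightarrow> rat" where
  "subgroup_sum G g = (\<Sum>H\<in>{H. subgroup H G \<and> g \<in> H}. 1 / of_nat (card H))"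

definition cyclic_orbits :: "'a pair_pre_digraph \<Rightarrow> ('a \<Rightarrow> 'a) \<Rightarrow> 'a set set" where
  "cyclic_orbits \<Gamma> g =
     orbits (aut_group \<Gamma>\<lparr>carrier := generate (aut_group \<Gamma>) {g}\<rparr>) (pverts \<Gamma>) (\<lambda>f. f)"

text \<open>The case \<open>A = B\<close> gives the loops of the quotient.\<close>

definition quotient_graph :: "'a pair_pre_digraph \<Rightarrow> ('a \<Rightarrow> 'a) \<Rightarrow> 'a set pair_pre_digraph" where
  "quotient_graph \<Gamma> g =
     \<lparr>pverts = cyclic_orbits \<Gamma> g,
      parcs = {(A, B). A \<in> cyclic_orbits \<Gamma> g \<and> B \<in> cyclic_orbits \<Gamma> g \<and>
                 (\<exists>u\<in>A. \<exists>v\<in>B. (u, v) \<in> parcs \<Gamma>)}\<rparr>"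

definition colourings :: "'a pair_pre_digraph \<Rightarrow> nat \<Rightarrow> nat \<Rightarrow> ('a \<Rightarrow> nat) set" where
  "colourings \<Lambda> x y =
     {c \<in> pverts \<Lambda> \<rightarrow>\<^sub>E {1..x}. \<forall>(u, v)\<in>parcs \<Lambda>. c u = c v \<longrightarrow> y < c u}"

text \<open>
  Polynomials in \<open>x\<close> and \<open>y\<close> are represented as polynomials in \<open>y\<close> whose coefficients are
  polynomials in \<open>x\<close>.
\<close>

definition eval2 :: "int poly poly \<Rightarrow> int \<Rightarrow> int \<Rightarrow> int" where
  "eval2 p x y = poly (poly p [:y:]) x"

definition bivariate_chromatic_poly :: "'a pair_pre_digraph \<Rightarrow> int poly poly" where
  "bivariate_chromatic_poly \<Lambda> =
     (THE p. \<forall>x y. y \<le> x \<longrightarrow> eval2 p (int x) (int y) = int (card (colourings \<Lambda> x y)))"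

text \<open>
  The remaining lemmas show that these notions are well defined: the automorphisms form a group,
  the quotient is again a graph, and the description in \<^const>\<open>bivariate_chromatic_poly\<close> is
  satisfied by exactly one polynomial.
\<close>

lemma group_aut_group: "group (aut_group \<Gamma>)"
proof -
  let ?V = "pverts \<Gamma>"
  let ?A = "{f \<in> Bij ?V. \<forall>u\<in>?V. \<forall>v\<in>?V. (f u, f v) \<in> parcs \<Gamma> \<longleftrightarrow> (u, v) \<in> parcs \<Gamma>}"
  interpret B: group "BijGroup ?V" by (rule group_BijGroup)
  have "subgroup ?A (BijGroup ?V)"
  proof (rule B.subgroupI)
    show "?A \<subseteq> carrier (BijGroup ?V)" by (auto simp: BijGroup_def)
    have "(\<lambda>x\<in>?V. x) \<in> ?A" using id_Bij[of ?V] by auto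
    then show "?A \<noteq> {}" by blast
  next
    fix f assume f: "f \<in> ?A"
    then have fB: "f \<in> Bij ?V" by simp
    have inv: "inv\<^bsub>BijGroup ?V\<^esub> f = (\<lambda>x\<in>?V. inv_into ?V f x)"
      by (rule inv_BijGroup[OF fB])
    have "(inv_into ?V f u, inv_into ?V f v) \<in> parcs \<Gamma> \<longleftrightarrow> (u, v) \<in> parcs \<Gamma>"
      if uv: "u \<in> ?V" "v \<in> ?V" for u v
    proof -
      have m: "inv_into ?V f u \<in> ?V" "inv_into ?V f v \<in> ?V"
        using uv Bij_inv_into_mem[OF fB] by auto
      have e: "f (inv_into ?V f u) = u" "f (inv_into ?V f v) = v"
        using uv fB by (auto simp: Bij_def bij_betw_def f_inv_into_f)
      have "(f (inv_into ?V f u), f (inv_into ?V f v)) \<in> parcs \<Gamma> \<longleftrightarrow>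
          (inv_into ?V f u, inv_into ?V f v) \<in> parcs \<Gamma>"
        using f m by blast
      then show ?thesis by (simp add: e)
    qed
    then show "inv\<^bsub>BijGroup ?V\<^esub> f \<in> ?A"
      using restrict_inv_into_Bij[OF fB] by (simp add: inv)
  next
    fix f g assume fg: "f \<in> ?A" "g \<in> ?A"
    then have B: "f \<in> Bij ?V" "g \<in> Bij ?V" by auto
    have "g u \<in> ?V" if "u \<in> ?V" for u using Bij_imp_funcset[OF B(2)] that by auto
    then show "f \<otimes>\<^bsub>BijGroup ?V\<^esub> g \<in> ?A"
      using fg B compose_Bij[OF B] by (simp add: BijGroup_def compose_eq)
  qed
  then show ?thesis
    unfolding aut_group_def by (rule B.subgroup_imp_group)
qed

lemma pair_pseudo_graph_quotient:
  assumes "pair_pseudo_graph \<Gamma>"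
  shows "pair_pseudo_graph (quotient_graph \<Gamma> g)"
proof -
  interpret pair_pseudo_graph \<Gamma> by fact
  have fin: "finite (cyclic_orbits \<Gamma> g)"
    unfolding cyclic_orbits_def orbits_def by (simp add: pair_finite_verts)
  have sym: "(v, u) \<in> parcs \<Gamma>" if "(u, v) \<in> parcs \<Gamma>" for u v
    using pair_sym_arcs that by (auto simp: symmetric_def dest: symD)
  show ?thesis
  proof
    show "finite (parcs (quotient_graph \<Gamma> g))"
      by (rule finite_subset[OF _ finite_cartesian_product[OF fin fin]])
        (auto simp: quotient_graph_def)
    show "symmetric (with_proj (quotient_graph \<Gamma> g))"
      by (auto simp: symmetric_def quotient_graph_def sym_def intro: sym)
  qed (auto simp: quotient_graph_def fin)
qed

lemma eval2_unique:
  assumes eq: "\<And>x y. y \<le> x \<Longrightarrow> eval2 p (int x) (int y) = eval2 q (int x) (int y)"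
  shows "p = q"
proof -
  define d where "d = p - q"
  have "poly d [:int y:] = 0" for y
  proof (rule ccontr)
    assume nz: "poly d [:int y:] \<noteq> 0"
    have "int ` {y..} \<subseteq> {x. poly (poly d [:int y:]) x = 0}"
      using eq by (auto simp: d_def eval2_def)
    moreover have "infinite (int ` {y..})"
      by (simp add: finite_image_iff infinite_Ici)
    ultimately show False using poly_roots_finite[OF nz] finite_subset by blast
  qed
  then have sub: "range (\<lambda>y. [:int y:]) \<subseteq> {x. poly d x = 0}" by auto
  have "infinite (range (\<lambda>y. [:int y:]))"
    by (rule range_inj_infinite) (auto simp: inj_def)
  then have "d = 0" using sub poly_roots_finite finite_subset by blast
  then show ?thesis by (simp add: d_def)
qed

lemma eval2_simps:
  "eval2 (p + q) x y = eval2 p x y + eval2 q x y"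
  "eval2 (p - q) x y = eval2 p x y - eval2 q x y"
  "eval2 (prod f A) x y = (\<Prod>a\<in>A. eval2 (f a) x y)"
  by (simp_all add: eval2_def poly_prod)

lemma monochromatic_count_poly:
  assumes "finite V" "F \<subseteq> V \<times> V"
  shows "\<exists>p. \<forall>x y. y \<le> x \<longrightarrow> eval2 p (int x) (int y) =
    int (card {c \<in> V \<rightarrow>\<^sub>E {1..x}. \<forall>(u, v)\<in>F. c u = c v \<and> c u \<le> y})"
proof -
  define cl where "cl v = {w. (v, w) \<in> (F \<union> F\<inverse>)\<^sup>*}" for v
  define T where "T x y C = (if C \<inter> Field F = {} then {1..x} else {1..y})" for x y :: nat and C
  define p :: "int poly poly" where
    "p = (\<Prod>C\<in>cl ` V. if C \<inter> Field F = {} then [:[:0, 1:]:] else [:0, 1:])"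
  have self: "v \<in> cl v" for v by (simp add: cl_def)
  have sym: "sym ((F \<union> F\<inverse>)\<^sup>*)" by (intro sym_rtrancl sym_Un_converse)
  have cl_eq: "cl u = cl v" if "(u, v) \<in> (F \<union> F\<inverse>)\<^sup>*" for u v
    using that sym by (auto simp: cl_def dest: symD intro: rtrancl_trans)
  have "bij_betw (\<lambda>d. \<lambda>v\<in>V. d (cl v)) (PiE (cl ` V) (T x y))
    {c \<in> V \<rightarrow>\<^sub>E {1..x}. \<forall>(u, v)\<in>F. c u = c v \<and> c u \<le> y}"
    (is "bij_betw ?h ?D ?C") if "y \<le> x" for x y
    unfolding bij_betw_def
  proof
    show "inj_on ?h ?D"
    proof (rule inj_onI)
      fix d e assume d: "d \<in> ?D" and e: "e \<in> ?D" and eq: "?h d = ?h e"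
      show "d = e"
      proof (rule PiE_ext[OF d e])
        fix C assume "C \<in> cl ` V"
        then obtain v where "v \<in> V" "C = cl v" by blast
        then show "d C = e C" using fun_cong[OF eq, of v] by simp
      qed
    qed
    show "?h ` ?D = ?C"
    proof (intro equalityI subsetI)
      fix c assume "c \<in> ?h ` ?D"
      then obtain d where d: "d \<in> ?D" and c: "c = ?h d" by blast
      have dT: "d (cl v) \<in> T x y (cl v)" if "v \<in> V" for v using d that by auto
      have "c \<in> V \<rightarrow>\<^sub>E {1..x}"
      proof (rule PiE_I)
        fix v assume "v \<in> V"
        then show "c v \<in> {1..x}"
          using dT[of v] \<open>y \<le> x\<close> by (auto simp: c T_def split: if_splits)
      qed (simp add: c)
      moreover have "c u = c v \<and> c u \<le> y" if uv: "(u, v) \<in> F" for u v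
      proof -
        have V: "u \<in> V" "v \<in> V" using uv assms by auto
        have "cl u = cl v" using uv by (intro cl_eq) auto
        moreover have "cl u \<inter> Field F \<noteq> {}" using uv self[of u] by (auto simp: Field_def)
        ultimately show ?thesis using dT[of u] V by (auto simp: c T_def)
      qed
      ultimately show "c \<in> ?C" by blast
    next
      fix c assume c: "c \<in> ?C"
      have step: "c u = c v" if "(u, v) \<in> F" for u v using that c by auto
      have const: "c u = c v" if "(u, v) \<in> (F \<union> F\<inverse>)\<^sup>*" for u v
        using that
      proof (induction rule: rtrancl_induct)
        case (step a b)
        then show ?case using \<open>\<And>u v. (u, v) \<in> F \<Longrightarrow> c u = c v\<close>[of a b]
            \<open>\<And>u v. (u, v) \<in> F \<Longrightarrow> c u = c v\<close>[of b a] by auto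
      qed simp
      have field: "c w \<le> y" if "w \<in> Field F" for w
        using that c by (force simp: Field_def)
      define d where "d = (\<lambda>C\<in>cl ` V. c (SOME w. w \<in> C))"
      have dc: "d (cl v) = c v" if "v \<in> V" for v
      proof -
        have "(SOME w. w \<in> cl v) \<in> cl v" using self[of v] by (rule someI)
        then have "c v = c (SOME w. w \<in> cl v)" by (intro const) (simp add: cl_def)
        then show ?thesis using that by (simp add: d_def)
      qed
      have "d \<in> ?D"
      proof (rule PiE_I)
        fix C assume "C \<in> cl ` V"
        then obtain v where v: "v \<in> V" "C = cl v" by blast
        have r: "c v \<in> {1..x}" using c v by auto
        have "c v \<le> y" if "w \<in> cl v" "w \<in> Field F" for w
          using const[of v w] field[of w] that by (simp add: cl_def)
        then show "d C \<in> T x y C" using r v by (auto simp: dc T_def)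
      qed (simp add: d_def)
      moreover have "c = ?h d"
      proof
        fix v show "c v = ?h d v"
          using c by (cases "v \<in> V") (auto simp: dc PiE_def extensional_def)
      qed
      ultimately show "c \<in> ?h ` ?D" by blast
    qed
  qed
  then have "card {c \<in> V \<rightarrow>\<^sub>E {1..x}. \<forall>(u, v)\<in>F. c u = c v \<and> c u \<le> y} =
      (\<Prod>C\<in>cl ` V. card (T x y C))" if "y \<le> x" for x y
    using that bij_betw_same_card card_PiE[of "cl ` V" "T x y"] assms(1) by fastforce
  moreover have "eval2 p (int x) (int y) = int (\<Prod>C\<in>cl ` V. card (T x y C))" for x y
    unfolding p_def eval2_simps(3) of_nat_prod
    by (rule prod.cong) (auto simp: T_def eval2_def)
  ultimately have "\<forall>x y. y \<le> x \<longrightarrow> eval2 p (int x) (int y) =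
      int (card {c \<in> V \<rightarrow>\<^sub>E {1..x}. \<forall>(u, v)\<in>F. c u = c v \<and> c u \<le> y})"
    by simp
  then show ?thesis by blast
qed

lemma mixed_count_poly:
  assumes "finite E" "finite V" "E \<subseteq> V \<times> V" "F \<subseteq> V \<times> V"
  shows "\<exists>p. \<forall>x y. y \<le> x \<longrightarrow> eval2 p (int x) (int y) =
    int (card {c \<in> V \<rightarrow>\<^sub>E {1..x}. (\<forall>(u, v)\<in>F. c u = c v \<and> c u \<le> y) \<and>
      (\<forall>(u, v)\<in>E. c u = c v \<longrightarrow> y < c u)})"
  using assms(1,3,4)
proof (induction E arbitrary: F rule: finite_induct)
  case empty
  then show ?case using monochromatic_count_poly[OF assms(2), of F] by simp
next
  case (insert e E)
  define N where "N E F x y = {c \<in> V \<rightarrow>\<^sub>E {1..x::nat}. (\<forall>(u, v)\<in>F. c u = c v \<and> c u \<le> y) \<and>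
      (\<forall>(u, v)\<in>E. c u = c v \<longrightarrow> y < c u)}" for E F x and y :: nat
  have E: "E \<subseteq> V \<times> V" and F: "F \<subseteq> V \<times> V" "insert e F \<subseteq> V \<times> V" using insert by auto
  obtain p where p: "\<And>x y. y \<le> x \<Longrightarrow> eval2 p (int x) (int y) = int (card (N E F x y))"
    using insert.IH[OF E F(1)] unfolding N_def by blast
  obtain q where q: "\<And>x y. y \<le> x \<Longrightarrow> eval2 q (int x) (int y) = int (card (N E (insert e F) x y))"
    using insert.IH[OF E F(2)] unfolding N_def by blast
  have "card (N E F x y) = card (N (insert e E) F x y) + card (N E (insert e F) x y)" for x y
  proof -
    have fin: "finite (N E F x y)" for E F
      unfolding N_def by (rule finite_subset[of _ "V \<rightarrow>\<^sub>E {1..x}"])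
        (auto intro!: finite_PiE assms(2))
    have "N E F x y = N (insert e E) F x y \<union> N E (insert e F) x y"
      by (cases e) (auto simp: N_def)
    moreover have "N (insert e E) F x y \<inter> N E (insert e F) x y = {}"
      by (cases e) (auto simp: N_def)
    ultimately show ?thesis by (simp add: card_Un_disjoint[OF fin fin])
  qed
  then have "eval2 (p - q) (int x) (int y) = int (card (N (insert e E) F x y))" if "y \<le> x" for x y
    using p[OF that] q[OF that] by (simp add: eval2_simps(2))
  then show ?case unfolding N_def by blast
qed

theorem bivariate_chromatic_poly_unique_exists:
  assumes "pair_pseudo_graph \<Lambda>"
  shows "\<exists>!p. \<forall>x y. y \<le> x \<longrightarrow> eval2 p (int x) (int y) = int (card (colourings \<Lambda> x y))"
proof -
  interpret pair_pseudo_graph \<Lambda> by fact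
  have "parcs \<Lambda> \<subseteq> pverts \<Lambda> \<times> pverts \<Lambda>"
    using arc_fst_in_verts arc_snd_in_verts by fastforce
  then have "\<exists>p. \<forall>x y. y \<le> x \<longrightarrow> eval2 p (int x) (int y) = int (card (colourings \<Lambda> x y))"
    using mixed_count_poly[OF pair_finite_arcs pair_finite_verts, of "{}"]
    by (simp add: colourings_def)
  then obtain p where
    p: "\<forall>x y. y \<le> x \<longrightarrow> eval2 p (int x) (int y) = int (card (colourings \<Lambda> x y))" ..
  show ?thesis
  proof (rule ex1I[of _ p])
    fix q assume "\<forall>x y. y \<le> x \<longrightarrow> eval2 q (int x) (int y) = int (card (colourings \<Lambda> x y))"
    with p show "q = p" by (intro eval2_unique) simp
  qed (rule p)
qed

lemma eval2_bivariate_chromatic_poly: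
  assumes "pair_pseudo_graph \<Lambda>" "y \<le> x"
  shows "eval2 (bivariate_chromatic_poly \<Lambda>) (int x) (int y) = int (card (colourings \<Lambda> x y))"
  using theI'[OF bivariate_chromatic_poly_unique_exists[OF assms(1)]] assms(2)
  unfolding bivariate_chromatic_poly_def by blast

end

theory Submission
  imports Defs
begin

text \<open>
  Conjugation by \<open>k \<in> G\<close> is an automorphism of \<open>G\<close>, so it permutes the subgroups of \<open>G\<close>, keeps
  their orders, and carries those containing \<open>g\<close> to those containing \<open>k g k\<inverse>\<close>. The two sums over
  subgroups therefore agree term by term (\<open>subgroup_sum_iso\<close>).

  For the quotients, \<open>k\<close> itself induces the isomorphism. Since \<open>(k x k\<inverse>) (k u) = k (x u)\<close>, the
  orbits of \<open>\<langle>k g k\<inverse>\<rangle> = k \<langle>g\<rangle> k\<inverse>\<close> are the images under \<open>k\<close> of the orbits of \<open>\<langle>g\<rangle>\<close>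
  (\<open>orbits_conjugate\<close>), and since \<open>k\<close> is an automorphism of the graph, some edge joins two orbits
  \<open>A\<close> and \<open>B\<close> iff some edge joins \<open>k A\<close> and \<open>k B\<close>; the case \<open>A = B\<close> takes care of the loops
  (\<open>quotient_graph_conjugate_iso\<close>).

  Colourings pull back along an isomorphism, so isomorphic graphs have equally many of them for
  all \<open>x\<close> and \<open>y\<close>, and these numbers determine the bivariate chromatic polynomial
  (\<open>bivariate_chromatic_poly_iso\<close>).
\<close>

lemma (in group) conjugation_iso:
  assumes "k \<in> carrier G"
  shows "(\<lambda>x. k \<otimes> x \<otimes> inv k) \<in> iso G G"
proof (rule isoI)
  have cancel: "inv k \<otimes> (k \<otimes> z) = z" if "z \<in> carrier G" for z
    using assms that by (simp add: m_assoc[symmetric])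
  show "(\<lambda>x. k \<otimes> x \<otimes> inv k) \<in> hom G G"
  proof (rule homI)
    fix x y assume "x \<in> carrier G" "y \<in> carrier G"
    then show "k \<otimes> (x \<otimes> y) \<otimes> inv k = k \<otimes> x \<otimes> inv k \<otimes> (k \<otimes> y \<otimes> inv k)"
      using assms by (simp add: m_assoc cancel)
  qed (use assms in simp)
  show "bij_betw (\<lambda>x. k \<otimes> x \<otimes> inv k) (carrier G) (carrier G)"
    using conjugation_is_bij[OF assms] by (simp cong: bij_betw_cong)
qed

text \<open>
  An isomorphism \<open>f\<close> matches the two index sets by \<open>H \<mapsto> f ` H\<close>, and \<open>card (f ` H) = card H\<close> by
  injectivity. For infinite groups the index sets may be infinite; they are then infinite together
  and both sums are 0.
\<close>

lemma subgroup_sum_iso: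
  assumes "group G" "group K" "f \<in> iso G K" "g \<in> carrier G"
  shows "subgroup_sum G g = subgroup_sum K (f g)"
proof -
  define f' where "f' = inv_into (carrier G) f"
  have f: "bij_betw f (carrier G) (carrier K)" using assms(3) by (simp add: iso_def)
  have f': "f' \<in> iso K G" unfolding f'_def by (rule group.iso_set_sym[OF assms(1,3)])
  have sub: "H \<subseteq> carrier L" if "subgroup H L" for H and L :: "('x, 'y) monoid_scheme"
    using that by (rule subgroup.subset)
  have ff': "f ` f' ` H = H" if "subgroup H K" for H
    unfolding f'_def using that sub f
    by (intro image_inv_into_cancel) (auto simp: bij_betw_def)
  have f'f: "f' ` f ` H = H" if "subgroup H G" for H
    unfolding f'_def using that sub f
    by (intro inv_into_image_cancel) (auto simp: bij_betw_def)
  have inj: "inj_on f H" if "subgroup H G" for H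
    using f sub[OF that] by (auto simp: bij_betw_def intro: inj_on_subset)
  show ?thesis
    unfolding subgroup_sum_def
  proof (rule sum.reindex_bij_witness[where i = "image f'" and j = "image f"])
    fix H assume H: "H \<in> {H. subgroup H G \<and> g \<in> H}"
    then show "f ` H \<in> {H. subgroup H K \<and> f g \<in> H}"
      using subgroup.iso_subgroup[OF _ assms(1-3)] by blast
    show "f' ` f ` H = H" using H f'f by blast
    show "1 / of_nat (card (f ` H)) = (1 / of_nat (card H) :: rat)"
      using H inj by (simp add: card_image)
  next
    fix H assume H: "H \<in> {H. subgroup H K \<and> f g \<in> H}"
    have "f' (f g) = g"
      unfolding f'_def using f assms(4) by (simp add: bij_betw_def)
    with H have "g \<in> f' ` H" by (metis (mono_tags, lifting) CollectD imageI)
    then show "f' ` H \<in> {H. subgroup H G \<and> g \<in> H}"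
      using H subgroup.iso_subgroup[OF _ assms(2,1) f'] by blast
    show "f ` f' ` H = H" using H ff' by blast
  qed
qed

lemma subgroup_sum_conjugate:
  assumes "group G" "conjugate_in G g h"
  shows "subgroup_sum G g = subgroup_sum G h"
proof -
  obtain k where g: "g \<in> carrier G" and k: "k \<in> carrier G" and h: "h = k \<otimes>\<^bsub>G\<^esub> g \<otimes>\<^bsub>G\<^esub> inv\<^bsub>G\<^esub> k"
    using assms(2) by (auto simp: conjugate_in_def)
  show ?thesis
    using subgroup_sum_iso[OF assms(1,1) group.conjugation_iso[OF assms(1) k] g] by (simp add: h)
qed

text \<open>
  The identity \<open>(k x k\<inverse>) (k u) = k (x u)\<close> says that the orbit of \<open>k u\<close> under \<open>k H k\<inverse>\<close> is the
  image under \<open>k\<close> of the orbit of \<open>u\<close> under \<open>H\<close>; as \<open>k\<close> permutes \<open>E\<close>, every orbit of \<open>k H k\<inverse>\<close>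
  is of this form.
\<close>

lemma (in group_action) orbits_conjugate:
  assumes k: "k \<in> carrier G" and H: "H \<subseteq> carrier G"
  shows "orbits (G\<lparr>carrier := (\<lambda>x. k \<otimes> x \<otimes> inv k) ` H\<rparr>) E \<phi> =
         image (\<phi> k) ` orbits (G\<lparr>carrier := H\<rparr>) E \<phi>"
proof -
  interpret group G using group_hom by (simp add: group_hom_def)
  have act: "\<phi> (k \<otimes> x \<otimes> inv k) (\<phi> k u) = \<phi> k (\<phi> x u)" if "x \<in> H" "u \<in> E" for x u
  proof -
    have x: "x \<in> carrier G" using that H by blast
    have ku: "\<phi> k u \<in> E" using k that by (auto intro: element_image)
    have "\<phi> (k \<otimes> x \<otimes> inv k) (\<phi> k u) = \<phi> ((k \<otimes> x \<otimes> inv k) \<otimes> k) u"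
      using that k x by (simp add: composition_rule)
    also have "(k \<otimes> x \<otimes> inv k) \<otimes> k = k \<otimes> x" using k x by (simp add: m_assoc)
    finally show ?thesis using that k x by (simp add: composition_rule)
  qed
  have orbit_image: "Group_Action.orbit (G\<lparr>carrier := C\<rparr>) \<phi> u = (\<lambda>x. \<phi> x u) ` C" for C u
    by (auto simp: Group_Action.orbit_def)
  have orb: "Group_Action.orbit (G\<lparr>carrier := (\<lambda>x. k \<otimes> x \<otimes> inv k) ` H\<rparr>) \<phi> (\<phi> k u) =
      \<phi> k ` Group_Action.orbit (G\<lparr>carrier := H\<rparr>) \<phi> u" if "u \<in> E" for u
    using act[OF _ that] by (simp add: orbit_image image_image)
  have orbits_image: "orbits (G\<lparr>carrier := C\<rparr>) E \<phi> = Group_Action.orbit (G\<lparr>carrier := C\<rparr>) \<phi> ` E" for C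
    by (auto simp: orbits_def)
  have "orbits (G\<lparr>carrier := (\<lambda>x. k \<otimes> x \<otimes> inv k) ` H\<rparr>) E \<phi> =
      Group_Action.orbit (G\<lparr>carrier := (\<lambda>x. k \<otimes> x \<otimes> inv k) ` H\<rparr>) \<phi> ` \<phi> k ` E"
    by (simp only: orbits_image surj_prop[OF k])
  then show ?thesis by (simp add: orbits_image image_image orb)
qed

lemma group_action_aut_group: "group_action (aut_group \<Gamma>) (pverts \<Gamma>) (\<lambda>f. f)"
  unfolding group_action_def
proof (intro group_hom.intro group_hom_axioms.intro homI)
  fix f assume "f \<in> carrier (aut_group \<Gamma>)"
  then show "f \<in> carrier (BijGroup (pverts \<Gamma>))" by (simp add: aut_group_def BijGroup_def)
qed (simp_all add: group_aut_group group_BijGroup, simp add: aut_group_def)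

text \<open>
  A homomorphism carries the subgroup generated by \<open>g\<close> to the one generated by the image of \<open>g\<close>;
  for conjugation this gives \<open>\<langle>k g k\<inverse>\<rangle> = k \<langle>g\<rangle> k\<inverse>\<close>.
\<close>

lemma cyclic_orbits_conjugate:
  assumes "g \<in> carrier (aut_group \<Gamma>)" "k \<in> carrier (aut_group \<Gamma>)"
  shows "cyclic_orbits \<Gamma> (k \<otimes>\<^bsub>aut_group \<Gamma>\<^esub> g \<otimes>\<^bsub>aut_group \<Gamma>\<^esub> inv\<^bsub>aut_group \<Gamma>\<^esub> k) =
         image k ` cyclic_orbits \<Gamma> g"
proof -
  let ?A = "aut_group \<Gamma>"
  let ?c = "\<lambda>x. k \<otimes>\<^bsub>?A\<^esub> x \<otimes>\<^bsub>?A\<^esub> inv\<^bsub>?A\<^esub> k"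
  interpret A: group ?A by (rule group_aut_group)
  interpret c: group_hom ?A ?A ?c
    using A.conjugation_iso[OF assms(2)]
    by (intro group_hom.intro group_hom_axioms.intro A.is_group) (simp add: iso_def)
  have "generate ?A {?c g} = ?c ` generate ?A {g}"
    using c.generate_img[of "{g}"] assms by simp
  then show ?thesis
    using group_action.orbits_conjugate[OF group_action_aut_group assms(2), of "generate ?A {g}"]
      assms(1) A.generate_incl[of "{g}"]
    by (simp add: cyclic_orbits_def)
qed

lemma cyclic_orbits_subset:
  assumes "g \<in> carrier (aut_group \<Gamma>)" "A \<in> cyclic_orbits \<Gamma> g"
  shows "A \<subseteq> pverts \<Gamma>"
proof -
  interpret group "aut_group \<Gamma>" by (rule group_aut_group)
  interpret group_action "aut_group \<Gamma>" "pverts \<Gamma>" "\<lambda>f. f" by (rule group_action_aut_group)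
  have "f u \<in> pverts \<Gamma>" if "f \<in> generate (aut_group \<Gamma>) {g}" "u \<in> pverts \<Gamma>" for f u
    using generate_in_carrier[of "{g}" f] that assms(1) by (auto intro: element_image)
  then show ?thesis using assms(2) by (auto simp: cyclic_orbits_def orbits_def Group_Action.orbit_def)
qed

text \<open>
  An arc is the pair of its endpoints, so the vertex map alone determines the whole isomorphism.
\<close>

lemma digraph_iso_with_projI:
  assumes "pair_wf_digraph \<Lambda>" "inj_on f (pverts \<Lambda>)"
    and "pverts \<Lambda>' = f ` pverts \<Lambda>" "parcs \<Lambda>' = map_prod f f ` parcs \<Lambda>"
  shows "digraph_iso (with_proj \<Lambda>) (with_proj \<Lambda>')"
proof -
  interpret pair_wf_digraph \<Lambda> by fact
  let ?hom = "\<lparr>iso_verts = f, iso_arcs = map_prod f f, iso_head = snd, iso_tail = fst\<rparr>"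
  have "parcs \<Lambda> \<subseteq> pverts \<Lambda> \<times> pverts \<Lambda>"
    using arc_fst_in_verts arc_snd_in_verts by fastforce
  then have "inj_on (map_prod f f) (parcs \<Lambda>)"
    using map_prod_inj_on[OF assms(2,2)] by (rule inj_on_subset[rotated])
  then have "digraph_isomorphism ?hom"
    using assms(2) wf_digraph_axioms by (simp add: digraph_isomorphism_def)
  moreover have "with_proj \<Lambda>' = app_iso ?hom (with_proj \<Lambda>)"
    using assms(3,4) by (simp add: with_proj_def app_iso_def)
  ultimately show ?thesis unfolding digraph_iso_def by blast
qed

text \<open>
  The isomorphism is \<open>A \<mapsto> k ` A\<close>. It is injective because \<open>k\<close> is injective on the vertices and
  orbits are sets of vertices; the latter matters since \<open>k\<close> has no meaning outside the graph.
\<close>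

lemma quotient_graph_conjugate_iso:
  assumes \<Gamma>: "pair_pseudo_graph \<Gamma>"
    and g: "g \<in> carrier (aut_group \<Gamma>)" and k: "k \<in> carrier (aut_group \<Gamma>)"
  shows "digraph_iso (with_proj (quotient_graph \<Gamma> g)) (with_proj (quotient_graph \<Gamma>
    (k \<otimes>\<^bsub>aut_group \<Gamma>\<^esub> g \<otimes>\<^bsub>aut_group \<Gamma>\<^esub> inv\<^bsub>aut_group \<Gamma>\<^esub> k)))"
proof (rule digraph_iso_with_projI[where f = "image k"])
  interpret Q: pair_pseudo_graph "quotient_graph \<Gamma> g"
    using \<Gamma> by (rule pair_pseudo_graph_quotient)
  show "pair_wf_digraph (quotient_graph \<Gamma> g)" by (rule Q.pair_wf_digraph_axioms)
  note V = cyclic_orbits_subset[OF g]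
  note orb = cyclic_orbits_conjugate[OF g k]
  have arcs: "(k u, k v) \<in> parcs \<Gamma> \<longleftrightarrow> (u, v) \<in> parcs \<Gamma>"
    if "u \<in> pverts \<Gamma>" "v \<in> pverts \<Gamma>" for u v
    using k that by (simp add: aut_group_def)
  show "inj_on (image k) (pverts (quotient_graph \<Gamma> g))"
    using k V by (intro inj_on_subset[OF inj_on_image_Pow])
      (auto simp: quotient_graph_def aut_group_def Bij_def bij_betw_def)
  show "pverts (quotient_graph \<Gamma> (k \<otimes>\<^bsub>aut_group \<Gamma>\<^esub> g \<otimes>\<^bsub>aut_group \<Gamma>\<^esub> inv\<^bsub>aut_group \<Gamma>\<^esub> k)) =
      image k ` pverts (quotient_graph \<Gamma> g)"
    by (simp add: quotient_graph_def orb)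
  define joined where "joined A B \<longleftrightarrow> (\<exists>u\<in>A. \<exists>v\<in>B. (u, v) \<in> parcs \<Gamma>)" for A B
  have "joined (k ` A) (k ` B) \<longleftrightarrow> joined A B"
    if "A \<in> cyclic_orbits \<Gamma> g" "B \<in> cyclic_orbits \<Gamma> g" for A B
    using V[OF that(1)] V[OF that(2)] by (simp add: joined_def subset_iff arcs cong: bex_cong)
  then show "parcs (quotient_graph \<Gamma> (k \<otimes>\<^bsub>aut_group \<Gamma>\<^esub> g \<otimes>\<^bsub>aut_group \<Gamma>\<^esub> inv\<^bsub>aut_group \<Gamma>\<^esub> k)) =
      map_prod (image k) (image k) ` parcs (quotient_graph \<Gamma> g)"
    unfolding quotient_graph_def orb pair_pre_digraph.simps joined_def[symmetric] by auto
qed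

text \<open>
  Pulling a colouring of \<open>\<Lambda>'\<close> back along an isomorphism \<open>f\<close> from \<open>\<Lambda>\<close> to \<open>\<Lambda>'\<close> gives a colouring of
  \<open>\<Lambda>\<close>, and it loses no information because \<open>f\<close> reaches every vertex of \<open>\<Lambda>'\<close>. An inequality is
  enough, because the inverse isomorphism yields the other one.
\<close>

lemma card_colourings_le:
  assumes fin: "finite (pverts \<Lambda>)" and iso: "digraph_iso (with_proj \<Lambda>) (with_proj \<Lambda>')"
  shows "card (colourings \<Lambda>' x y) \<le> card (colourings \<Lambda> x y)"
proof -
  obtain hom where hom: "pre_digraph.digraph_isomorphism (with_proj \<Lambda>) hom"
    and app: "with_proj \<Lambda>' = app_iso hom (with_proj \<Lambda>)"
    using iso by (auto simp: digraph_iso_def)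
  interpret wf_digraph "with_proj \<Lambda>"
    using hom by (simp add: pre_digraph.digraph_isomorphism_def)
  define f where "f = iso_verts hom"
  have verts: "pverts \<Lambda>' = f ` pverts \<Lambda>"
    using arg_cong[OF app, of verts] by (simp add: f_def)
  have arcs: "parcs \<Lambda>' = (\<lambda>(u, v). (f u, f v)) ` parcs \<Lambda>"
    using arg_cong[OF app, of arcs_ends] arcs_ends_app_iso_eq[OF hom] by (simp add: f_def)
  have V: "u \<in> pverts \<Lambda>" "v \<in> pverts \<Lambda>" if "(u, v) \<in> parcs \<Lambda>" for u v
    using that wellformed[of "(u, v)"] by auto
  let ?r = "\<lambda>c. \<lambda>v\<in>pverts \<Lambda>. c (f v)"
  show ?thesis
  proof (rule card_inj_on_le[where f = ?r])
    show "inj_on ?r (colourings \<Lambda>' x y)"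
    proof (rule inj_onI)
      fix c d assume c: "c \<in> colourings \<Lambda>' x y" and d: "d \<in> colourings \<Lambda>' x y"
        and eq: "?r c = ?r d"
      have "c \<in> pverts \<Lambda>' \<rightarrow>\<^sub>E {1..x}" "d \<in> pverts \<Lambda>' \<rightarrow>\<^sub>E {1..x}"
        using c d by (auto simp: colourings_def)
      then show "c = d"
      proof (rule PiE_ext)
        fix w assume "w \<in> pverts \<Lambda>'"
        then obtain v where "v \<in> pverts \<Lambda>" "w = f v" using verts by blast
        then show "c w = d w" using fun_cong[OF eq, of v] by simp
      qed
    qed
    show "?r ` colourings \<Lambda>' x y \<subseteq> colourings \<Lambda> x y"
      using V by (fastforce simp: colourings_def verts arcs)
    show "finite (colourings \<Lambda> x y)"
      unfolding colourings_def
      by (rule finite_subset[of _ "pverts \<Lambda> \<rightarrow>\<^sub>E {1..x}"]) (auto intro!: finite_PiE fin)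
  qed
qed

lemma bivariate_chromatic_poly_iso:
  assumes \<Lambda>: "pair_pseudo_graph \<Lambda>" and \<Lambda>': "pair_pseudo_graph \<Lambda>'"
    and iso: "digraph_iso (with_proj \<Lambda>) (with_proj \<Lambda>')"
  shows "bivariate_chromatic_poly \<Lambda> = bivariate_chromatic_poly \<Lambda>'"
proof -
  interpret pair_pseudo_graph \<Lambda> by fact
  interpret L': pair_pseudo_graph \<Lambda>' by fact
  have "digraph_iso (with_proj \<Lambda>') (with_proj \<Lambda>)"
    using digraph_iso_swap[OF wf_digraph_axioms iso] .
  then have "card (colourings \<Lambda> x y) = card (colourings \<Lambda>' x y)" for x y
    using card_colourings_le[OF pair_finite_verts iso]
      card_colourings_le[OF L'.pair_finite_verts] by (intro antisym)
  then show ?thesis by (simp add: bivariate_chromatic_poly_def)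
qed

theorem proposition3p6:
  fixes \<Gamma> :: "'a pair_pre_digraph" and G :: "('a \<Rightarrow> 'a) set"
  assumes "pair_pseudo_graph \<Gamma>"
    and "subgroup G (aut_group \<Gamma>)"
  shows "(\<forall>g\<in>G. \<forall>h\<in>G. conjugate_in (aut_group \<Gamma>\<lparr>carrier := G\<rparr>) g h \<longrightarrow>
            subgroup_sum (aut_group \<Gamma>\<lparr>carrier := G\<rparr>) g =
            subgroup_sum (aut_group \<Gamma>\<lparr>carrier := G\<rparr>) h) \<and>
         (\<forall>g\<in>G. \<forall>h\<in>G. conjugate_in (aut_group \<Gamma>\<lparr>carrier := G\<rparr>) g h \<longrightarrow>
            digraph_iso (with_proj (quotient_graph \<Gamma> g)) (with_proj (quotient_graph \<Gamma> h)) \<and>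
            bivariate_chromatic_poly (quotient_graph \<Gamma> g) =
            bivariate_chromatic_poly (quotient_graph \<Gamma> h))"
proof (intro conjI ballI impI)
  let ?G = "aut_group \<Gamma>\<lparr>carrier := G\<rparr>"
  interpret A: group "aut_group \<Gamma>" by (rule group_aut_group)
  interpret G: group ?G using assms(2) by (rule A.subgroup_imp_group)
  fix g h assume conj: "conjugate_in ?G g h"
  show "subgroup_sum ?G g = subgroup_sum ?G h"
    by (rule subgroup_sum_conjugate[OF G.is_group conj])
  obtain k where k: "g \<in> G" "k \<in> G"
    "h = k \<otimes>\<^bsub>aut_group \<Gamma>\<^esub> g \<otimes>\<^bsub>aut_group \<Gamma>\<^esub> inv\<^bsub>aut_group \<Gamma>\<^esub> k"
    using conj A.m_inv_consistent[OF assms(2)] by (auto simp: conjugate_in_def)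
  then show iso: "digraph_iso (with_proj (quotient_graph \<Gamma> g)) (with_proj (quotient_graph \<Gamma> h))"
    using quotient_graph_conjugate_iso[OF assms(1)] subgroup.subset[OF assms(2)] by blast
  show "bivariate_chromatic_poly (quotient_graph \<Gamma> g) =
      bivariate_chromatic_poly (quotient_graph \<Gamma> h)"
    by (rule bivariate_chromatic_poly_iso[OF pair_pseudo_graph_quotient pair_pseudo_graph_quotient iso])
      (rule assms(1))+
qed

end
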